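(* Let $G_2$ be the graph with vertex set $\{u_1,\dots,u_8\}$ and edge set $\{u_1u_2,\,u_1u_3,\,u_2u_3,\,u_2u_4,\,u_3u_5,\,u_4u_5,\,u_4u_6,\,u_5u_7,\,u_6u_7,\,u_6u_8,\,u_7u_8\}$. Then $G_2$ is $2$-connected, subcubic and outerplanar, but it is not $(1,2^3,3)$-packing edge-colorable.
   Context: A graph is subcubic if its maximum degree is at most $3$. The distance between two distinct edges of a graph $G$ is their distance in the line graph of $G$, so edges sharing an endpoint are at distance $1$. For a non-decreasing sequence $S=(s_1,\dots,s_k)$ of positive integers, an $S$-packing edge-coloring ($S$-coloring) of $G$ is a partition of $E(G)$ into (possibly empty) classes $E_1,\dots,E_k$ such that for each $i$ any two distinct edges in $E_i$ are at distance at least $s_i+1$. Exponents denote repetition: $(1,2^3,3)=(1,2,2,2,3)$. *)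

theory Defs
  imports "HOL-Analysis.Analysis" "HOL-Library.Extended_Nat"
begin

record 'a graph =
  verts :: "'a set"
  edges :: "'a set set"

definition simple_graph :: "'a graph \<Rightarrow> bool" where
  "simple_graph G \<longleftrightarrow> finite (verts G) \<and> (\<forall>e\<in>edges G. e \<subseteq> verts G \<and> card e = 2)"

definition degree_of :: "'a graph \<Rightarrow> 'a \<Rightarrow> nat" where
  "degree_of G v = card {e \<in> edges G. v \<in> e}"

definition max_degree :: "'a graph \<Rightarrow> nat" where
  "max_degree G = Max (degree_of G ` verts G)"

definition subcubic :: "'a graph \<Rightarrow> bool" where
  "subcubic G \<longleftrightarrow> max_degree G \<le> 3"

definition path_between :: "'a graph \<Rightarrow> 'a \<Rightarrow> 'a list \<Rightarrow> 'a \<Rightarrow> bool" where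
  "path_between G x p y \<longleftrightarrow>
     p \<noteq> [] \<and> hd p = x \<and> last p = y \<and> set p \<subseteq> verts G \<and> distinct p \<and>
     successively (\<lambda>a b. {a, b} \<in> edges G) p"

text \<open>The number of edges on a shortest path; it is \<open>\<infinity>\<close> (the infimum of the empty set)
  if there is no path.\<close>

definition graph_dist :: "'a graph \<Rightarrow> 'a \<Rightarrow> 'a \<Rightarrow> enat" where
  "graph_dist G x y = (INF p \<in> {p. path_between G x p y}. enat (length p - 1))"

definition connected_graph :: "'a graph \<Rightarrow> bool" where
  "connected_graph G \<longleftrightarrow>
     verts G \<noteq> {} \<and> (\<forall>x\<in>verts G. \<forall>y\<in>verts G. \<exists>p. path_between G x p y)"

definition delete_verts :: "'a graph \<Rightarrow> 'a set \<Rightarrow> 'a graph" where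
  "delete_verts G X =
     \<lparr>verts = verts G - X, edges = {e \<in> edges G. e \<inter> X = {}}\<rparr>"

definition k_connected :: "nat \<Rightarrow> 'a graph \<Rightarrow> bool" where
  "k_connected k G \<longleftrightarrow>
     k < card (verts G) \<and>
     (\<forall>X. X \<subseteq> verts G \<and> card X < k \<longrightarrow> connected_graph (delete_verts G X))"

definition plane_embedding ::
    "'a graph \<Rightarrow> ('a \<Rightarrow> complex) \<Rightarrow> ('a set \<Rightarrow> real \<Rightarrow> complex) \<Rightarrow> bool" where
  "plane_embedding G \<phi> \<gamma> \<longleftrightarrow>
     inj_on \<phi> (verts G) \<and>
     (\<forall>e\<in>edges G. arc (\<gamma> e) \<and> {pathstart (\<gamma> e), pathfinish (\<gamma> e)} = \<phi> ` e) \<and>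
     (\<forall>e\<in>edges G. path_image (\<gamma> e) \<inter> \<phi> ` verts G = \<phi> ` e) \<and>
     (\<forall>e\<in>edges G. \<forall>f\<in>edges G. e \<noteq> f \<longrightarrow>
        path_image (\<gamma> e) \<inter> path_image (\<gamma> f) = \<phi> ` (e \<inter> f))"

definition drawing ::
    "'a graph \<Rightarrow> ('a \<Rightarrow> complex) \<Rightarrow> ('a set \<Rightarrow> real \<Rightarrow> complex) \<Rightarrow> complex set" where
  "drawing G \<phi> \<gamma> = \<phi> ` verts G \<union> (\<Union>e\<in>edges G. path_image (\<gamma> e))"

text \<open>The drawing of a finite graph is compact, so its complement has exactly one unbounded
  component, the outer face, and \<^const>\<open>outside\<close> is that component.\<close>

definition outerplanar :: "'a graph \<Rightarrow> bool" where
  "outerplanar G \<longleftrightarrow>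
     (\<exists>\<phi> \<gamma>. plane_embedding G \<phi> \<gamma> \<and>
            \<phi> ` verts G \<subseteq> frontier (outside (drawing G \<phi> \<gamma>)))"

definition line_graph :: "'a graph \<Rightarrow> 'a set graph" where
  "line_graph G =
     \<lparr>verts = edges G,
      edges = {{e, f} | e f. e \<in> edges G \<and> f \<in> edges G \<and> e \<noteq> f \<and> e \<inter> f \<noteq> {}}\<rparr>"

definition edge_dist :: "'a graph \<Rightarrow> 'a set \<Rightarrow> 'a set \<Rightarrow> enat" where
  "edge_dist G e f = graph_dist (line_graph G) e f"

text \<open>The sequence \<open>S\<close> is a list indexed from \<open>0\<close>; it is meant to be non-decreasing with positive
  entries. The classes \<open>C i\<close> may be empty.\<close>

definition packing_edge_coloring :: "nat list \<Rightarrow> 'a graph \<Rightarrow> (nat \<Rightarrow> 'a set set) \<Rightarrow> bool" where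
  "packing_edge_coloring S G C \<longleftrightarrow>
     (\<Union>i<length S. C i) = edges G \<and>
     (\<forall>i<length S. \<forall>j<length S. i \<noteq> j \<longrightarrow> C i \<inter> C j = {}) \<and>
     (\<forall>i<length S. \<forall>e\<in>C i. \<forall>f\<in>C i. e \<noteq> f \<longrightarrow> edge_dist G e f \<ge> enat (S ! i + 1))"

definition packing_edge_colorable :: "nat list \<Rightarrow> 'a graph \<Rightarrow> bool" where
  "packing_edge_colorable S G \<longleftrightarrow> (\<exists>C. packing_edge_coloring S G C)"

definition G2 :: "nat graph" where
  "G2 = \<lparr>verts = {1..8},
         edges = {{1, 2}, {1, 3}, {2, 3}, {2, 4}, {3, 5}, {4, 5}, {4, 6}, {5, 7},
                  {6, 7}, {6, 8}, {7, 8}}\<rparr>"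

lemma simple_graph_G2: "simple_graph G2"
  by (simp add: simple_graph_def G2_def)

end

theory Submission
  imports Defs
begin

text \<open>
  A Hamiltonian cycle with a vertex removed is a Hamiltonian path, hence \<^term>\<open>G2\<close> is 2-connected.
  Placing the vertices on a parabola in the order \<open>1, 2, 4, 6, 8, 7, 5, 3\<close> of that cycle and drawing
  the edges as chords gives an outerplanar embedding: all vertices lie on the boundary of the convex
  epigraph, which contains the drawing. Finally, balls in the line graph bound edge distances from
  above, and these bounds turn the colouring problem into an unsatisfiable propositional formula.
\<close>

section \<open>Hamiltonian cycles and 2-connectedness\<close>

text \<open>The target may come after or before the source along a Hamiltonian path, so a segment is
  provided in both directions.\<close>

lemma subpath_between:
  assumes "set (as @ q @ bs) \<subseteq> verts G" "distinct (as @ q @ bs)" "q \<noteq> []"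
    and "successively (\<lambda>a b. {a, b} \<in> edges G) (as @ q @ bs)"
  shows "path_between G (hd q) q (last q)" and "path_between G (last q) (rev q) (hd q)"
  using assms
  by (auto simp: path_between_def successively_append_iff hd_rev last_rev insert_commute)

lemma connected_graph_if_hamiltonian_path:
  assumes "p \<noteq> []" "set p = verts G" "distinct p"
    and "successively (\<lambda>a b. {a, b} \<in> edges G) p"
  shows "connected_graph G"
  unfolding connected_graph_def
proof (intro conjI ballI)
  show "verts G \<noteq> {}"
    using assms(1,2) by auto
next
  fix x y
  assume "x \<in> verts G" "y \<in> verts G"
  then obtain as bs where p: "p = as @ x # bs"
    using assms(2) by (metis split_list)
  consider "y \<in> set (x # bs)" | "y \<in> set as"
    using p \<open>y \<in> verts G\<close> assms(2) by auto
  then show "\<exists>p. path_between G x p y"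
  proof cases
    case 1
    then obtain cs ds where cs: "x # bs = cs @ y # ds"
      by (metis split_list)
    then have "p = as @ (cs @ [y]) @ ds" "hd (cs @ [y]) = x"
      using p by (auto simp: hd_append Cons_eq_append_conv)
    then show ?thesis
      using subpath_between(1)[of as "cs @ [y]" ds G] assms by auto
  next
    case 2
    then obtain cs ds where "as = cs @ y # ds"
      by (metis split_list)
    then have "p = cs @ (y # ds @ [x]) @ bs"
      using p by simp
    then show ?thesis
      using subpath_between(2)[of cs "y # ds @ [x]" bs G] assms by auto
  qed
qed

lemma two_connected_if_hamiltonian_cycle:
  assumes "3 \<le> length p" "set p = verts G" "distinct p"
    and succ: "successively (\<lambda>a b. {a, b} \<in> edges G) p"
    and cycle: "{last p, hd p} \<in> edges G"
  shows "k_connected 2 G"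
  unfolding k_connected_def
proof (intro conjI allI impI)
  show "2 < card (verts G)"
    using assms(1-3) distinct_card[of p] by simp
next
  fix X
  assume X: "X \<subseteq> verts G \<and> card X < 2"
  then have "finite X"
    using assms(2) by (metis List.finite_set finite_subset)
  then consider "X = {}" | x where "X = {x}"
  proof (cases "card X = 0")
    case False
    then have "card X = 1"
      using X by simp
    then show ?thesis
      using that(2) by (rule card_1_singletonE)
  qed (use that(1) in auto)
  then show "connected_graph (delete_verts G X)"
  proof cases
    case 1
    then have "delete_verts G X = G"
      by (simp add: delete_verts_def)
    moreover have "p \<noteq> []"
      using assms(1) by auto
    ultimately show ?thesis
      using connected_graph_if_hamiltonian_path assms(2,3) succ by metis
  next
    case 2
    then obtain as bs where p: "p = as @ x # bs"
      using X assms(2) split_list[of x p] by auto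
    \<comment> \<open>Starting the cycle just after \<open>x\<close> lists the other vertices as
      \<open>bs @ as\<close>; if both parts are nonempty, the closing edge
      \<open>{last p, hd p}\<close> joins them.\<close>
    have succ': "successively (\<lambda>a b. {a, b} \<in> edges G) (bs @ as)"
      using succ cycle unfolding p by (auto simp: successively_append_iff successively_Cons hd_append split: if_splits)
    have x: "x \<notin> set (bs @ as)"
      using assms(3) p by auto
    have "successively (\<lambda>a b. {a, b} \<in> edges (delete_verts G X)) (bs @ as)"
      by (rule successively_mono[OF succ']) (use x 2 in \<open>auto simp: delete_verts_def\<close>)
    moreover have "bs @ as \<noteq> []" "distinct (bs @ as)"
      using assms(1,3) p by auto
    moreover have "set (bs @ as) = verts (delete_verts G X)"
      using assms(2,3) unfolding p 2 by (auto simp: delete_verts_def)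
    ultimately show ?thesis
      by (intro connected_graph_if_hamiltonian_path)
  qed
qed

section \<open>Drawings with vertices on a parabola\<close>

text \<open>Points of a strictly convex curve are in convex position, so two chords cross exactly
  when their parameters strictly interleave.\<close>

definition parabola :: "real \<Rightarrow> complex" where
  "parabola t = Complex t (t\<^sup>2)"

lemma inj_parabola: "inj parabola"
  by (auto simp: inj_def parabola_def)

lemma convex_epigraph_square: "convex {z. (Re z)\<^sup>2 \<le> Im z}"
proof (rule convexI)
  fix z w :: complex and u v :: real
  assume *: "z \<in> {z. (Re z)\<^sup>2 \<le> Im z}" "w \<in> {z. (Re z)\<^sup>2 \<le> Im z}" "0 \<le> u" "0 \<le> v" "u + v = 1"
  then have v: "v = 1 - u" by simp
  \<comment> \<open>The gap in Jensen's inequality for the square is exactly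
    \<open>u * v * (Re z - Re w)\<^sup>2\<close>.\<close>
  have "(u * Re z + v * Re w)\<^sup>2 + u * v * (Re z - Re w)\<^sup>2 = u * (Re z)\<^sup>2 + v * (Re w)\<^sup>2"
    unfolding v by (simp add: power2_eq_square algebra_simps)
  moreover have "0 \<le> u * v * (Re z - Re w)\<^sup>2"
    using * by simp
  moreover have "u * (Re z)\<^sup>2 \<le> u * Im z" "v * (Re w)\<^sup>2 \<le> v * Im w"
    using * by (auto intro: mult_left_mono)
  ultimately show "u *\<^sub>R z + v *\<^sub>R w \<in> {z. (Re z)\<^sup>2 \<le> Im z}"
    by simp
qed

text \<open>The chord lies on the line y = (a + b) x - a b, whose excess over the parabola factors
  as (x - a) (b - x): nonnegative between the ends and zero only there.\<close>

lemma chord_coordinates: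
  assumes "z \<in> closed_segment (parabola a) (parabola b)" "a < b"
  shows "a \<le> Re z" "Re z \<le> b" "Im z = (Re z)\<^sup>2 + (Re z - a) * (b - Re z)"
proof -
  obtain u where u: "0 \<le> u" "u \<le> 1" "z = (1 - u) *\<^sub>R parabola a + u *\<^sub>R parabola b"
    using assms(1) by (auto simp: closed_segment_def)
  have Re: "Re z = a + u * (b - a)"
    by (simp add: u(3) parabola_def algebra_simps)
  show "a \<le> Re z"
    using u(1) assms(2) by (simp add: Re)
  have "u * (b - a) \<le> 1 * (b - a)"
    using u(2) assms(2) by (intro mult_right_mono) auto
  then show "Re z \<le> b"
    by (simp add: Re)
  have "Im z = (1 - u) * a\<^sup>2 + u * b\<^sup>2"
    by (simp add: u(3) parabola_def)
  then show "Im z = (Re z)\<^sup>2 + (Re z - a) * (b - Re z)"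
    by (simp add: Re power2_eq_square algebra_simps)
qed

lemma chord_subset_epigraph:
  "a < b \<Longrightarrow> closed_segment (parabola a) (parabola b) \<subseteq> {z. (Re z)\<^sup>2 \<le> Im z}"
  using chord_coordinates by fastforce

lemma chord_meets_parabola:
  assumes "parabola t \<in> closed_segment (parabola a) (parabola b)" "a < b"
  shows "t \<in> {a, b}"
  using chord_coordinates(3)[OF assms] by (auto simp: parabola_def)

text \<open>The four disjuncts exclude only strict interleaving of the intervals; weak inequalities
  admit chords with a common end point.\<close>

definition noncrossing :: "real \<Rightarrow> real \<Rightarrow> real \<Rightarrow> real \<Rightarrow> bool" where
  "noncrossing a b c d \<longleftrightarrow> b \<le> c \<or> d \<le> a \<or> a \<le> c \<and> d \<le> b \<or> c \<le> a \<and> b \<le> d"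

text \<open>At a common point both chords have the same excess over the parabola. The difference of
  the two excesses is a sum of two nonnegative terms, so both terms vanish.\<close>

lemma nested_chords_meet:
  assumes z: "z \<in> closed_segment (parabola a) (parabola b)"
    "z \<in> closed_segment (parabola c) (parabola d)"
    and "a < b" "c < d" "(a, b) \<noteq> (c, d)" "a \<le> c" "d \<le> b"
  shows "z \<in> parabola ` ({a, b} \<inter> {c, d})"
proof -
  define x where "x = Re z"
  note ab = chord_coordinates[OF z(1) \<open>a < b\<close>, folded x_def]
  note cd = chord_coordinates[OF z(2) \<open>c < d\<close>, folded x_def]
  have "(x - a) * (b - x) = (x - c) * (d - x)"
    using ab(3) cd(3) by simp
  then have "(x - c) * (b - d) + (c - a) * (b - x) = 0"
    by (simp add: algebra_simps)
  moreover have "0 \<le> (x - c) * (b - d)" "0 \<le> (c - a) * (b - x)"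
    using ab cd assms by auto
  ultimately have "(x = c \<or> b = d) \<and> (c = a \<or> x = b)"
    by (smt (verit) mult_eq_0_iff)
  \<comment> \<open>Of the four combinations, \<open>b = d\<close> with \<open>c = a\<close>
    contradicts the distinctness of the chords, and \<open>x = c\<close> with \<open>x = b\<close>
    contradicts \<open>c < d \<le> b\<close>.\<close>
  then have "x = c \<and> c = a \<or> x = d \<and> d = b"
    using assms cd by auto
  moreover have "z = Complex x (Im z)"
    by (simp add: x_def)
  ultimately show ?thesis
    using ab(3) by (auto simp: parabola_def)
qed

lemma noncrossing_chords_meet:
  assumes z: "z \<in> closed_segment (parabola a) (parabola b)"
    "z \<in> closed_segment (parabola c) (parabola d)"
    and "a < b" "c < d" "(a, b) \<noteq> (c, d)" "noncrossing a b c d"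
  shows "z \<in> parabola ` ({a, b} \<inter> {c, d})"
proof -
  note ab = chord_coordinates[OF z(1) \<open>a < b\<close>]
  note cd = chord_coordinates[OF z(2) \<open>c < d\<close>]
  consider "b \<le> c" | "d \<le> a" | "a \<le> c" "d \<le> b" | "c \<le> a" "b \<le> d"
    using assms(6) by (auto simp: noncrossing_def)
  then show ?thesis
  proof cases
    case 1
    then have "Re z = b" "b = c"
      using ab cd by auto
    then have "z = parabola b"
      using ab(3) by (simp add: parabola_def complex_eq_iff)
    then show ?thesis
      using \<open>b = c\<close> by auto
  next
    case 2
    then have "Re z = a" "d = a"
      using ab cd by auto
    then have "z = parabola a"
      using ab(3) by (simp add: parabola_def complex_eq_iff)
    then show ?thesis
      using \<open>d = a\<close> by auto
  next
    case 3
    then show ?thesis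
      using nested_chords_meet[OF z] assms by auto
  next
    case 4
    then show ?thesis
      using nested_chords_meet[OF z(2,1)] assms by (auto simp: Int_commute)
  qed
qed

text \<open>The complement of the convex epigraph is its own outside, hence lies outside the smaller
  set \<open>S\<close>. Points straight below \<open>parabola t\<close> are therefore outside
  \<open>S\<close> and converge to it, while it belongs to \<open>S\<close> itself.\<close>

lemma parabola_in_frontier_outside:
  assumes "S \<subseteq> {z. (Re z)\<^sup>2 \<le> Im z}" "parabola t \<in> S"
  shows "parabola t \<in> frontier (outside S)"
proof -
  have "- {z. (Re z)\<^sup>2 \<le> Im z} \<subseteq> outside S"
    using outside_mono[OF assms(1)] outside_convex[OF convex_epigraph_square] by simp
  then have below: "Complex t (t\<^sup>2 - e) \<in> outside S" if "0 < e" for e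
    using that by auto
  have "parabola t \<in> closure (outside S)"
    unfolding closure_approachable
  proof (intro allI impI)
    fix e :: real
    assume "0 < e"
    have "dist (Complex t (t\<^sup>2 - e / 2)) (parabola t) = e / 2"
      using \<open>0 < e\<close> by (simp add: parabola_def dist_norm norm_complex_def)
    then show "\<exists>y\<in>outside S. dist y (parabola t) < e"
      using below[of "e / 2"] \<open>0 < e\<close> by (intro bexI[of _ "Complex t (t\<^sup>2 - e / 2)"]) auto
  qed
  moreover have "parabola t \<notin> interior (outside S)"
    using assms(2) outside_no_overlap[of S] interior_subset by blast
  ultimately show ?thesis
    by (simp add: frontier_def)
qed

lemma outerplanar_if_noncrossing:
  fixes G :: "'a graph" and \<pi> :: "'a \<Rightarrow> real"
  assumes "simple_graph G" and inj: "inj_on \<pi> (verts G)"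
    and nc: "\<And>e f. e \<in> edges G \<Longrightarrow> f \<in> edges G \<Longrightarrow>
      noncrossing (Min (\<pi> ` e)) (Max (\<pi> ` e)) (Min (\<pi> ` f)) (Max (\<pi> ` f))"
  shows "outerplanar G"
proof -
  define \<phi> where "\<phi> v = parabola (\<pi> v)" for v
  \<comment> \<open>Directing each chord from the smaller to the larger parameter meets the
    condition \<open>a < b\<close> of the chord lemmas.\<close>
  define \<gamma> where "\<gamma> e = linepath (parabola (Min (\<pi> ` e))) (parabola (Max (\<pi> ` e)))" for e
  have \<phi>: "inj_on \<phi> (verts G)"
    using inj inj_parabola by (auto simp: \<phi>_def inj_on_def)
  have sub: "e \<subseteq> verts G" if "e \<in> edges G" for e
    using that assms(1) by (auto simp: simple_graph_def)
  have ends: "\<pi> ` e = {Min (\<pi> ` e), Max (\<pi> ` e)} \<and> Min (\<pi> ` e) < Max (\<pi> ` e)"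
    if "e \<in> edges G" for e
  proof -
    have "card e = 2"
      using that assms(1) by (auto simp: simple_graph_def)
    then obtain u v where e: "e = {u, v}" "u \<noteq> v"
      by (auto simp: card_2_iff)
    then have "\<pi> u \<noteq> \<pi> v"
      using sub[OF that] inj by (auto simp: inj_on_def)
    then show ?thesis
      by (auto simp: e min_def max_def)
  qed
  have \<phi>_ends: "\<phi> ` e = {parabola (Min (\<pi> ` e)), parabola (Max (\<pi> ` e))}" if "e \<in> edges G" for e
  proof -
    have "\<phi> ` e = parabola ` (\<pi> ` e)"
      by (auto simp: \<phi>_def)
    also have "\<dots> = parabola ` {Min (\<pi> ` e), Max (\<pi> ` e)}"
      using ends[OF that] by (metis (no_types))
    finally show ?thesis by simp
  qed
  have img: "path_image (\<gamma> e) = closed_segment (parabola (Min (\<pi> ` e))) (parabola (Max (\<pi> ` e)))" for e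
    by (simp add: \<gamma>_def)
  have \<phi>_sub: "\<phi> ` e \<subseteq> path_image (\<gamma> e)" if "e \<in> edges G" for e
    by (simp add: img \<phi>_ends[OF that])
  have arcs: "arc (\<gamma> e) \<and> {pathstart (\<gamma> e), pathfinish (\<gamma> e)} = \<phi> ` e" if "e \<in> edges G" for e
    using ends[OF that] inj_parabola \<phi>_ends[OF that]
    by (auto simp: \<gamma>_def inj_eq intro!: arc_linepath)
  have verts: "path_image (\<gamma> e) \<inter> \<phi> ` verts G = \<phi> ` e" if "e \<in> edges G" for e
  proof
    show "path_image (\<gamma> e) \<inter> \<phi> ` verts G \<subseteq> \<phi> ` e"
    proof
      fix z
      assume "z \<in> path_image (\<gamma> e) \<inter> \<phi> ` verts G"
      then obtain v where v: "z = parabola (\<pi> v)" "z \<in> path_image (\<gamma> e)"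
        by (auto simp: \<phi>_def)
      then have "\<pi> v \<in> {Min (\<pi> ` e), Max (\<pi> ` e)}"
        using ends[OF that] by (intro chord_meets_parabola) (simp_all add: img)
      then show "z \<in> \<phi> ` e"
        using v(1) \<phi>_ends[OF that] by auto
    qed
    show "\<phi> ` e \<subseteq> path_image (\<gamma> e) \<inter> \<phi> ` verts G"
      using \<phi>_sub[OF that] sub[OF that] by auto
  qed
  have disj: "path_image (\<gamma> e) \<inter> path_image (\<gamma> f) = \<phi> ` (e \<inter> f)"
    if ef: "e \<in> edges G" "f \<in> edges G" "e \<noteq> f" for e f
  proof
    have \<phi>_Int: "\<phi> ` (e \<inter> f) = \<phi> ` e \<inter> \<phi> ` f"
      using sub ef \<phi> by (intro inj_on_image_Int[of _ "verts G"]) auto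
    have "\<pi> ` e \<noteq> \<pi> ` f"
      using sub ef inj_on_image_eq_iff[OF inj] by auto
    \<comment> \<open>\<open>Min\<close> and \<open>Max\<close> determine the two-element image of
      an edge, so distinct edges give distinct chords.\<close>
    then have ne: "(Min (\<pi> ` e), Max (\<pi> ` e)) \<noteq> (Min (\<pi> ` f), Max (\<pi> ` f))"
      using ends[OF ef(1)] ends[OF ef(2)] by (metis prod.inject)
    show "path_image (\<gamma> e) \<inter> path_image (\<gamma> f) \<subseteq> \<phi> ` (e \<inter> f)"
    proof
      fix z
      assume "z \<in> path_image (\<gamma> e) \<inter> path_image (\<gamma> f)"
      then have "z \<in> parabola ` ({Min (\<pi> ` e), Max (\<pi> ` e)} \<inter> {Min (\<pi> ` f), Max (\<pi> ` f)})"
        using noncrossing_chords_meet[OF _ _ _ _ ne nc] ends ef by (simp add: img)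
      then show "z \<in> \<phi> ` (e \<inter> f)"
        unfolding \<phi>_Int \<phi>_ends[OF ef(1)] \<phi>_ends[OF ef(2)] by auto
    qed
    show "\<phi> ` (e \<inter> f) \<subseteq> path_image (\<gamma> e) \<inter> path_image (\<gamma> f)"
      using \<phi>_sub ef by blast
  qed
  have "plane_embedding G \<phi> \<gamma>"
    unfolding plane_embedding_def using \<phi> arcs verts disj by blast
  moreover have "drawing G \<phi> \<gamma> \<subseteq> {z. (Re z)\<^sup>2 \<le> Im z}"
  proof -
    have "\<phi> ` verts G \<subseteq> {z. (Re z)\<^sup>2 \<le> Im z}"
      by (auto simp: \<phi>_def parabola_def)
    moreover have "path_image (\<gamma> e) \<subseteq> {z. (Re z)\<^sup>2 \<le> Im z}" if "e \<in> edges G" for e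
      unfolding img using ends[OF that] by (intro chord_subset_epigraph) simp
    ultimately show ?thesis
      unfolding drawing_def by blast
  qed
  then have "\<phi> v \<in> frontier (outside (drawing G \<phi> \<gamma>))" if "v \<in> verts G" for v
    unfolding \<phi>_def using that
    by (intro parabola_in_frontier_outside) (auto simp: drawing_def \<phi>_def)
  ultimately show ?thesis
    unfolding outerplanar_def by blast
qed

section \<open>Balls in the line graph\<close>

text \<open>Unlike an infimum over paths, this recursion can be evaluated on an explicit edge set. A
  nonempty edge meets itself, so the rounds accumulate and describe distance at most
  \<open>n\<close>.\<close>

fun edge_ball :: "'a graph \<Rightarrow> nat \<Rightarrow> 'a set \<Rightarrow> 'a set set" where
  "edge_ball G 0 e = {e}"
| "edge_ball G (Suc n) e = (\<Union>x\<in>edge_ball G n e. {f \<in> edges G. f \<inter> x \<noteq> {}})"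

lemma edge_ball_path:
  assumes "e \<in> edges G" "f \<in> edge_ball G n e"
  shows "\<exists>p. path_between (line_graph G) e p f \<and> length p - 1 \<le> n"
  using assms(2)
proof (induction n arbitrary: f)
  case 0
  then show ?case
    using assms(1) by (intro exI[of _ "[e]"]) (auto simp: path_between_def line_graph_def)
next
  case (Suc n)
  then obtain x where x: "x \<in> edge_ball G n e" "f \<in> edges G" "f \<inter> x \<noteq> {}"
    by auto
  obtain p where p: "path_between (line_graph G) e p x" "length p - 1 \<le> n"
    using Suc.IH[OF x(1)] by blast
  show ?case
  \<comment> \<open>Paths must be \<open>distinct\<close>, so a walk returning to an old vertex
    \<open>f\<close> is cut at \<open>f\<close> instead of extended.\<close>
  proof (cases "f \<in> set p")
    case True
    then obtain as bs where as: "p = as @ f # bs"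
      by (metis split_list)
    then have "path_between (line_graph G) e (as @ [f]) f"
      using p(1) by (auto simp: path_between_def successively_append_iff hd_append)
    then show ?thesis
      using as p(2) by (intro exI[of _ "as @ [f]"]) auto
  next
    case False
    have "x \<in> set p" "x \<in> edges G"
      using p(1) by (auto simp: path_between_def line_graph_def)
    then have "{x, f} \<in> edges (line_graph G)"
      using x False by (auto simp: line_graph_def)
    then have "path_between (line_graph G) e (p @ [f]) f"
      using p(1) False x(2) by (auto simp: path_between_def successively_append_iff line_graph_def)
    then show ?thesis
      using p(2) by (intro exI[of _ "p @ [f]"]) auto
  qed
qed

lemma edge_dist_le_if_in_edge_ball:
  assumes "e \<in> edges G" "f \<in> edge_ball G n e"
  shows "edge_dist G e f \<le> enat n"
proof -
  obtain p where p: "path_between (line_graph G) e p f" "length p - 1 \<le> n"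
    using edge_ball_path[OF assms] by blast
  then have "edge_dist G e f \<le> enat (length p - 1)"
    unfolding edge_dist_def graph_dist_def by (intro INF_lower) simp
  then show ?thesis
    using p(2) by (meson enat_ord_simps(1) order_trans)
qed

text \<open>Ball members are within distance \<open>S ! i\<close>, one less than two edges of class
  \<open>i\<close> must keep; the distance condition thus becomes a statement about membership
  alone.\<close>

lemma packing_edge_coloring_edge_ball:
  assumes "packing_edge_coloring S G C" "i < length S" "e \<in> C i"
  shows "\<forall>f\<in>edge_ball G (S ! i) e. f \<noteq> e \<longrightarrow> f \<notin> C i"
proof (intro ballI impI notI)
  fix f
  assume f: "f \<in> edge_ball G (S ! i) e" "f \<noteq> e" "f \<in> C i"
  have "e \<in> edges G"
    using assms by (auto simp: packing_edge_coloring_def)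
  then have "edge_dist G e f \<le> enat (S ! i)"
    using edge_dist_le_if_in_edge_ball f(1) by blast
  moreover have "enat (S ! i + 1) \<le> edge_dist G e f"
    using assms f unfolding packing_edge_coloring_def by blast
  ultimately have "enat (S ! i + 1) \<le> enat (S ! i)"
    by (rule order_trans[rotated])
  then show False
    by simp
qed

section \<open>The graph \<open>G2\<close>\<close>

text \<open>Filters an explicit finite set element by element, which lets degrees and edge
  neighbourhoods be computed by rewriting.\<close>

lemma Collect_insert_conj:
  "{x \<in> insert a A. P x} = (if P a then insert a {x \<in> A. P x} else {x \<in> A. P x})"
  by auto

lemma verts_G2: "verts G2 = {1, 2, 3, 4, 5, 6, 7, 8}"
  by (auto simp: G2_def)

lemma edges_G2:
  "edges G2 = {{1, 2}, {1, 3}, {2, 3}, {2, 4}, {3, 5}, {4, 5}, {4, 6}, {5, 7},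
     {6, 7}, {6, 8}, {7, 8}}"
  by (simp add: G2_def)

lemma k_connected_2_G2: "k_connected 2 G2"
  by (rule two_connected_if_hamiltonian_cycle[of "[1, 2, 4, 6, 8, 7, 5, 3]"])
    (auto simp: verts_G2 edges_G2 doubleton_eq_iff)

lemma subcubic_G2: "subcubic G2"
  unfolding subcubic_def max_degree_def degree_of_def verts_G2 edges_G2 Collect_insert_conj
  by (simp add: doubleton_eq_iff)

text \<open>The parameters are positions along the Hamiltonian cycle. The three edges off the cycle,
  \<open>{2, 3}\<close>, \<open>{4, 5}\<close> and \<open>{6, 7}\<close>, get the nested intervals
  [1,7], [2,6] and [3,5].\<close>

lemma outerplanar_G2: "outerplanar G2"
proof (rule outerplanar_if_noncrossing[OF simple_graph_G2])
  \<comment> \<open>the first list entry is padding: the vertices are numbered from \<open>1\<close>\<close>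
  define \<pi> :: "nat \<Rightarrow> real" where "\<pi> v = [0, 0, 1, 7, 2, 6, 3, 5, 4] ! v" for v
  show "inj_on \<pi> (verts G2)"
    by (simp add: verts_G2 \<pi>_def)
  show "noncrossing (Min (\<pi> ` e)) (Max (\<pi> ` e)) (Min (\<pi> ` f)) (Max (\<pi> ` f))"
    if "e \<in> edges G2" "f \<in> edges G2" for e f
    using that unfolding edges_G2
    by (elim insertE emptyE) (simp_all add: \<pi>_def noncrossing_def)
qed

lemma not_colorable_G2: "\<not> packing_edge_colorable [1, 2, 2, 2, 3] G2"
proof
  assume "packing_edge_colorable [1, 2, 2, 2, 3] G2"
  then obtain C where C: "packing_edge_coloring [1, 2, 2, 2, 3] G2 C"
    by (auto simp: packing_edge_colorable_def)
  have "(\<Union>i<5. C i) = edges G2"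
    using C by (simp add: packing_edge_coloring_def numeral_eq_Suc)
  moreover have "{..<5} = {0, 1, 2, 3, 4::nat}"
    by auto
  ultimately have "\<forall>e\<in>edges G2. e \<in> C 0 \<or> e \<in> C 1 \<or> e \<in> C 2 \<or> e \<in> C 3 \<or> e \<in> C 4"
    by auto
  note cover = this[unfolded edges_G2, simplified]
  \<comment> \<open>Closed neighbourhoods in the line graph: each edge lies in its own
    \<open>N\<close>, so iterating \<open>N\<close> produces the balls.\<close>
  define N where "N x = {f \<in> edges G2. f \<inter> x \<noteq> {}}" for x
  have N: "N {1, 2} = {{1, 2}, {1, 3}, {2, 3}, {2, 4}}"
    "N {1, 3} = {{1, 2}, {1, 3}, {2, 3}, {3, 5}}"
    "N {2, 3} = {{1, 2}, {1, 3}, {2, 3}, {2, 4}, {3, 5}}"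
    "N {2, 4} = {{1, 2}, {2, 3}, {2, 4}, {4, 5}, {4, 6}}"
    "N {3, 5} = {{1, 3}, {2, 3}, {3, 5}, {4, 5}, {5, 7}}"
    "N {4, 5} = {{2, 4}, {3, 5}, {4, 5}, {4, 6}, {5, 7}}"
    "N {4, 6} = {{2, 4}, {4, 5}, {4, 6}, {6, 7}, {6, 8}}"
    "N {5, 7} = {{3, 5}, {4, 5}, {5, 7}, {6, 7}, {7, 8}}"
    "N {6, 7} = {{4, 6}, {5, 7}, {6, 7}, {6, 8}, {7, 8}}"
    "N {6, 8} = {{4, 6}, {6, 7}, {6, 8}, {7, 8}}"
    "N {7, 8} = {{5, 7}, {6, 7}, {6, 8}, {7, 8}}"
    unfolding N_def edges_G2 Collect_insert_conj by simp_all
  have ball: "e \<in> C i \<longrightarrow> (\<forall>f\<in>edge_ball G2 ([1, 2, 2, 2, 3] ! i) e. f \<noteq> e \<longrightarrow> f \<notin> C i)"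
    if "i < 5" for e i
    using packing_edge_coloring_edge_ball[OF C] that by simp
  \<comment> \<open>The number of nested \<open>N\<close> quantifiers is the radius: 1 for class 0,
    2 for classes 1 to 3, and 3 for class 4.\<close>
  have near: "e \<in> C 0 \<longrightarrow> (\<forall>f\<in>N e. f \<noteq> e \<longrightarrow> f \<notin> C 0)"
    "e \<in> C 1 \<longrightarrow> (\<forall>x\<in>N e. \<forall>f\<in>N x. f \<noteq> e \<longrightarrow> f \<notin> C 1)"
    "e \<in> C 2 \<longrightarrow> (\<forall>x\<in>N e. \<forall>f\<in>N x. f \<noteq> e \<longrightarrow> f \<notin> C 2)"
    "e \<in> C 3 \<longrightarrow> (\<forall>x\<in>N e. \<forall>f\<in>N x. f \<noteq> e \<longrightarrow> f \<notin> C 3)"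
    "e \<in> C 4 \<longrightarrow> (\<forall>x\<in>N e. \<forall>y\<in>N x. \<forall>f\<in>N y. f \<noteq> e \<longrightarrow> f \<notin> C 4)" for e
    using ball[of 0 e] ball[of 1 e] ball[of 2 e] ball[of 3 e] ball[of 4 e]
    by (simp_all add: numeral_eq_Suc N_def)
  note near_at = near[of "{1, 2}"] near[of "{1, 3}"] near[of "{2, 3}"] near[of "{2, 4}"]
    near[of "{3, 5}"] near[of "{4, 5}"] near[of "{4, 6}"] near[of "{5, 7}"]
    near[of "{6, 7}"] near[of "{6, 8}"] near[of "{7, 8}"]
  \<comment> \<open>The table \<open>N\<close> turns the bounded quantifiers into finite
    conjunctions, and \<open>doubleton_eq_iff\<close> decides each \<open>f \<noteq> e\<close>. What
    remains is propositional in the 55 atoms \<open>e \<in> C i\<close>.\<close>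
  note conflicts = near_at[simplified N ball_simps, simplified doubleton_eq_iff, simplified]
  show False
    using cover conflicts by sat
qed

theorem mainTheorem6:
  "k_connected 2 G2 \<and> subcubic G2 \<and> outerplanar G2 \<and>
   \<not> packing_edge_colorable [1, 2, 2, 2, 3] G2"
  using k_connected_2_G2 subcubic_G2 outerplanar_G2 not_colorable_G2 by blast

end
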